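(* (Completeness of $\mathbf{FRJ}(G)$ and $\mathbf{GBU}(G)$.) For every propositional formula $G$: (i) if $G\notin\mathrm{IPL}$ then $G$ is provable in $\mathbf{FRJ}(G)$, i.e. some regular sequent $\Gamma\Rightarrow G$ is derivable in $\mathbf{FRJ}(G)$; (ii) if $G\in\mathrm{IPL}$ then the regular sequent $\emptyset\Rightarrow_g G$ is derivable in $\mathbf{GBU}(G)$.
   Context: Formulas are built from a countably infinite set $\mathcal{V}$ of propositional variables and $\bot$ using $\land,\lor,\supset$. Let $\mathcal{V}_\bot=\mathcal{V}\cup\{\bot\}$, $\mathcal{L}^{\supset}$ the set of formulas with main connective $\supset$. For a formula $G$, $\mathrm{Sl}(G)$ and $\mathrm{Sr}(G)$ (left/right subformulas) are the smallest subsets of the subformulas of $G$ with: $G\in\mathrm{Sr}(G)$; $A\land B$ or $A\lor B$ in $\mathrm{Sl}(G)$ (resp. $\mathrm{Sr}(G)$) implies $A,B$ in $\mathrm{Sl}(G)$ (resp. $\mathrm{Sr}(G)$); $A\supset B\in\mathrm{Sl}(G)$ implies $B\in\mathrm{Sl}(G)$, $A\in\mathrm{Sr}(G)$; $A\supset B\in\mathrm{Sr}(G)$ implies $B\in\mathrm{Sr}(G)$, $A\in\mathrm{Sl}(G)$. $\mathrm{Cl}(\Gamma)$ is the smallest set containing $\Gamma$ such that if $X,Y\in\mathrm{Cl}(\Gamma)$ and $A$ is any formula then $X\land Y,A\lor X,X\lor A,A\supset X\in\mathrm{Cl}(\Gamma)$. Commas denote union. $\mathbf{FRJ}(G)$: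 let $\bar\Gamma^{At}=\mathrm{Sl}(G)\cap\mathcal V$, $\bar\Gamma^{\supset}=\mathrm{Sl}(G)\cap\mathcal L^{\supset}$, $\bar\Gamma=\bar\Gamma^{At}\cup\bar\Gamma^{\supset}$. Sequents: regular $\Gamma\Rightarrow C$ ($\Gamma\subseteq\bar\Gamma$, $C\in\mathrm{Sr}(G)$), irregular $\Sigma;\Theta\rightarrow C$ ($\Sigma\cup\Theta\subseteq\bar\Gamma$, $C\in\mathrm{Sr}(G)$); conclusions always have right formula in $\mathrm{Sr}(G)$. Rules ($F\in\mathcal V_\bot$, $k\in\{1,2\}$): axioms $\bar\Gamma^{At}\setminus\{F\}\Rightarrow F$ and $\emptyset;(\bar\Gamma^{At}\setminus\{F\})\cup\bar\Gamma^{\supset}\rightarrow F$; ($\land$) $\Gamma\Rightarrow A_k/\Gamma\Rightarrow A_1\land A_2$ and $\Sigma;\Theta\rightarrow A_k/\Sigma;\Theta\rightarrow A_1\land A_2$; ($\lor$) $\Sigma_1;\Theta_1\rightarrow C_1$, $\Sigma_2;\Theta_2\rightarrow C_2 / \Sigma_1\cup\Sigma_2;\Theta_1\cap\Theta_2\rightarrow C_1\lor C_2$ if $\Sigma_1\subseteq\Sigma_2\cup\Theta_2$, $\Sigma_2\subseteq\Sigma_1\cup\Theta_1$; ($\supset_\in$) $\Gamma\Rightarrow B/\Gamma\Rightarrow A\supset B$ if $A\in\mathrm{Cl}(\Gamma)$, and $\Sigma;\Theta\cup\Lambda\rightarrow B/\Sigma\cup\Lambda;\Theta\rightarrow A\supset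 B$ if $\Theta\cap\Lambda=\emptyset$, $A\in\mathrm{Cl}(\Sigma\cup\Lambda)$ and (R1) no proper subset $\Lambda'\subsetneq\Lambda$ has $A\in\mathrm{Cl}(\Sigma\cup\Lambda')$; ($\supset_{\notin}$) $\Gamma\Rightarrow B/\emptyset;\Theta\rightarrow A\supset B$ if $\Theta\subseteq\mathrm{Cl}(\Gamma)\cap\bar\Gamma$, $A\in\mathrm{Cl}(\Gamma)\setminus\mathrm{Cl}(\Theta)$ and (R2) every $\Theta'$ with $\Theta\subsetneq\Theta'\subseteq\mathrm{Cl}(\Gamma)\cap\bar\Gamma$ has $A\in\mathrm{Cl}(\Theta')$; join rules with premises $\Sigma_j;\Theta_j\rightarrow A_j$ ($1\le j\le n$, $n\ge1$): let $\Upsilon=\{A_1,\dots,A_n\}$, $\Sigma^{At}=\bigcup_j(\Sigma_j\cap\mathcal V)$, $\Sigma^{\supset}=\bigcup_j(\Sigma_j\cap\mathcal L^{\supset})$, $\Theta^{At}=\bigcap_j(\Theta_j\cap\mathcal V)$, $\Theta^{\supset}=\{Y\supset Z\in\bigcap_j(\Theta_j\cap\mathcal L^{\supset}):Y\in\Upsilon\}$, requiring $\Sigma_i\subseteq\Sigma_j\cup\Theta_j$ ($i\ne j$) and ($Y\supset Z\in\Sigma^{\supset}\Rightarrow Y\in\Upsilon$); ($\bowtie^{At}$) conclusion $\Sigma^{At}\cup(\Theta^{At}\setminus\{F\})\cup\Sigma^{\supset}\cup\Theta^{\supset}\Rightarrow F$, $F\in\mathcal V_\bot\setminus\Sigma^{At}$,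 with (R3) each $Y\in\Upsilon$ has some $Y\supset Z\in\mathrm{Sl}(G)$; ($\bowtie^{\lor}$) conclusion $\Sigma^{At}\cup\Theta^{At}\cup\Sigma^{\supset}\cup\Theta^{\supset}\Rightarrow C_1\lor C_2$, $\{C_1,C_2\}\subseteq\Upsilon$, with (R4) each $Y\in\Upsilon$ has some $Y\supset Z\in\mathrm{Sl}(G)$ or $Y\lor Z\in\mathrm{Sr}(G)$ or $Z\lor Y\in\mathrm{Sr}(G)$. $\mathbf{GBU}(G)$: sequents regular $\Psi\Rightarrow_g A$ and irregular $\Psi\rightarrow_g A$ with $\Psi\subseteq\mathrm{Sl}(G)$, $A\in\mathrm{Sr}(G)$ (all sequents in rules satisfy this). Rules ($k\in\{1,2\}$): axioms $A,\Psi\Rightarrow_g A$, $\bot,\Psi\Rightarrow_g C$, $A,\Psi\rightarrow_g A$; $L\land$: $A,B,\Psi\Rightarrow_g C/A\land B,\Psi\Rightarrow_g C$; $R\land$: $\Psi\Rightarrow_g A$, $\Psi\Rightarrow_g B/\Psi\Rightarrow_g A\land B$ and likewise with $\rightarrow_g$ throughout; $L\lor$: $A,\Psi\Rightarrow_g C$, $B,\Psi\Rightarrow_g C/A\lor B,\Psi\Rightarrow_g C$; $R\lor_k$: $\Psi\rightarrow_g C_k/\Psi\Rightarrow_g C_1\lor C_2$ and $\Psi\rightarrow_g C_k/\Psi\rightarrow_g C_1\lor C_2$; $L\supset$: $A\supset B,\Psi\rightarrow_g A$, $B,\Psi\Rightarrow_g C/A\supset B,\Psi\Rightarrow_g C$;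 $\supset R_\in$: $\Psi\Rightarrow_g B/\Psi\Rightarrow_g A\supset B$ and $\Psi\rightarrow_g B/\Psi\rightarrow_g A\supset B$, if $A\in\mathrm{Cl}(\Psi)$; $\supset R_{\notin}$: $A,\Psi\Rightarrow_g B/\Psi\Rightarrow_g A\supset B$ and $A,\Psi\Rightarrow_g B/\Psi\rightarrow_g A\supset B$, if $A\notin\mathrm{Cl}(\Psi)$. *)

theory Defs
  imports Main
begin

datatype form =
    Var nat
  | Bot                 (\<open>\<^bold>\<bottom>\<close>)
  | And form form       (infixr \<open>\<^bold>\<and>\<close> 75)
  | Or form form        (infixr \<open>\<^bold>\<or>\<close> 70)
  | Imp form form       (infixr \<open>\<^bold>\<supset>\<close> 65)

text \<open>Intuitionistic propositional logic: the theorems of natural deduction \<open>NJ\<close>.\<close>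

inductive nj :: "form set \<Rightarrow> form \<Rightarrow> bool" where
  ass:   "A \<in> \<Gamma> \<Longrightarrow> nj \<Gamma> A"
| botE:  "nj \<Gamma> \<^bold>\<bottom> \<Longrightarrow> nj \<Gamma> A"
| andI:  "nj \<Gamma> A \<Longrightarrow> nj \<Gamma> B \<Longrightarrow> nj \<Gamma> (A \<^bold>\<and> B)"
| andE1: "nj \<Gamma> (A \<^bold>\<and> B) \<Longrightarrow> nj \<Gamma> A"
| andE2: "nj \<Gamma> (A \<^bold>\<and> B) \<Longrightarrow> nj \<Gamma> B"
| orI1:  "nj \<Gamma> A \<Longrightarrow> nj \<Gamma> (A \<^bold>\<or> B)"
| orI2:  "nj \<Gamma> B \<Longrightarrow> nj \<Gamma> (A \<^bold>\<or> B)"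
| orE:   "nj \<Gamma> (A \<^bold>\<or> B) \<Longrightarrow> nj (insert A \<Gamma>) C \<Longrightarrow> nj (insert B \<Gamma>) C \<Longrightarrow> nj \<Gamma> C"
| impI:  "nj (insert A \<Gamma>) B \<Longrightarrow> nj \<Gamma> (A \<^bold>\<supset> B)"
| impE:  "nj \<Gamma> (A \<^bold>\<supset> B) \<Longrightarrow> nj \<Gamma> A \<Longrightarrow> nj \<Gamma> B"

definition IPL :: "form set" where
  "IPL = {A. nj {} A}"

definition PV :: "form set" where
  "PV = range Var"

definition PV_bot :: "form set" where
  "PV_bot = insert \<^bold>\<bottom> PV"

definition L_imp :: "form set" where
  "L_imp = {A \<^bold>\<supset> B | A B. True}"

inductive_set Sl :: "form \<Rightarrow> form set" and Sr :: "form \<Rightarrow> form set" for G :: form where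
  Sr_refl: "G \<in> Sr G"
| Sl_and1: "A \<^bold>\<and> B \<in> Sl G \<Longrightarrow> A \<in> Sl G"
| Sl_and2: "A \<^bold>\<and> B \<in> Sl G \<Longrightarrow> B \<in> Sl G"
| Sr_and1: "A \<^bold>\<and> B \<in> Sr G \<Longrightarrow> A \<in> Sr G"
| Sr_and2: "A \<^bold>\<and> B \<in> Sr G \<Longrightarrow> B \<in> Sr G"
| Sl_or1:  "A \<^bold>\<or> B \<in> Sl G \<Longrightarrow> A \<in> Sl G"
| Sl_or2:  "A \<^bold>\<or> B \<in> Sl G \<Longrightarrow> B \<in> Sl G"
| Sr_or1:  "A \<^bold>\<or> B \<in> Sr G \<Longrightarrow> A \<in> Sr G"
| Sr_or2:  "A \<^bold>\<or> B \<in> Sr G \<Longrightarrow> B \<in> Sr G"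
| Sl_imp1: "A \<^bold>\<supset> B \<in> Sl G \<Longrightarrow> B \<in> Sl G"
| Sl_imp2: "A \<^bold>\<supset> B \<in> Sl G \<Longrightarrow> A \<in> Sr G"
| Sr_imp1: "A \<^bold>\<supset> B \<in> Sr G \<Longrightarrow> B \<in> Sr G"
| Sr_imp2: "A \<^bold>\<supset> B \<in> Sr G \<Longrightarrow> A \<in> Sl G"

inductive_set Cl :: "form set \<Rightarrow> form set" for \<Gamma> :: "form set" where
  Cl_base: "X \<in> \<Gamma> \<Longrightarrow> X \<in> Cl \<Gamma>"
| Cl_and:  "X \<in> Cl \<Gamma> \<Longrightarrow> Y \<in> Cl \<Gamma> \<Longrightarrow> X \<^bold>\<and> Y \<in> Cl \<Gamma>"
| Cl_or1:  "X \<in> Cl \<Gamma> \<Longrightarrow> X \<^bold>\<or> A \<in> Cl \<Gamma>"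
| Cl_or2:  "X \<in> Cl \<Gamma> \<Longrightarrow> A \<^bold>\<or> X \<in> Cl \<Gamma>"
| Cl_imp:  "X \<in> Cl \<Gamma> \<Longrightarrow> A \<^bold>\<supset> X \<in> Cl \<Gamma>"

definition bar_At :: "form \<Rightarrow> form set" where
  "bar_At G = Sl G \<inter> PV"

definition bar_imp :: "form \<Rightarrow> form set" where
  "bar_imp G = Sl G \<inter> L_imp"

definition bar :: "form \<Rightarrow> form set" where
  "bar G = bar_At G \<union> bar_imp G"

text \<open>
  Data of the join rules for premises \<open>S j; T j \<rightarrow> A j\<close>, with \<open>1 \<le> j \<le> n\<close>:
  \<open>S\<close>, \<open>T\<close> and \<open>A\<close> are families of which only the indices \<open>1, \<dots>, n\<close> matter.
\<close>

definition join_Ups :: "nat \<Rightarrow> (nat \<Rightarrow> form) \<Rightarrow> form set" where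
  "join_Ups n A = A ` {1..n}"

definition join_SAt :: "nat \<Rightarrow> (nat \<Rightarrow> form set) \<Rightarrow> form set" where
  "join_SAt n S = (\<Union>j\<in>{1..n}. S j \<inter> PV)"

definition join_Simp :: "nat \<Rightarrow> (nat \<Rightarrow> form set) \<Rightarrow> form set" where
  "join_Simp n S = (\<Union>j\<in>{1..n}. S j \<inter> L_imp)"

definition join_TAt :: "nat \<Rightarrow> (nat \<Rightarrow> form set) \<Rightarrow> form set" where
  "join_TAt n T = (\<Inter>j\<in>{1..n}. T j \<inter> PV)"

definition join_Timp :: "nat \<Rightarrow> (nat \<Rightarrow> form set) \<Rightarrow> (nat \<Rightarrow> form) \<Rightarrow> form set" where
  "join_Timp n T A =
     {Y \<^bold>\<supset> Z | Y Z. Y \<^bold>\<supset> Z \<in> (\<Inter>j\<in>{1..n}. T j \<inter> L_imp) \<and> Y \<in> join_Ups n A}"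

definition join_ok ::
  "nat \<Rightarrow> (nat \<Rightarrow> form set) \<Rightarrow> (nat \<Rightarrow> form set) \<Rightarrow> (nat \<Rightarrow> form) \<Rightarrow> bool" where
  "join_ok n S T A \<longleftrightarrow>
     1 \<le> n \<and>
     (\<forall>i\<in>{1..n}. \<forall>j\<in>{1..n}. i \<noteq> j \<longrightarrow> S i \<subseteq> S j \<union> T j) \<and>
     (\<forall>Y Z. Y \<^bold>\<supset> Z \<in> join_Simp n S \<longrightarrow> Y \<in> join_Ups n A)"

text \<open>
  \<open>frj_reg G \<Gamma> C\<close> and \<open>frj_irr G \<Sigma> \<Theta> C\<close> say that the regular sequent \<open>\<Gamma> \<Rightarrow> C\<close> and the
  irregular sequent \<open>\<Sigma>; \<Theta> \<rightarrow> C\<close> are derivable in \<open>FRJ(G)\<close>. Only the condition that the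
  right formula of a conclusion lies in \<open>Sr G\<close> is imposed explicitly; that the left
  sets are contained in \<open>bar G\<close> then holds of every derivable sequent
  (lemma \<open>frj_sequent\<close> below).
\<close>

inductive frj_reg :: "form \<Rightarrow> form set \<Rightarrow> form \<Rightarrow> bool"
  and frj_irr :: "form \<Rightarrow> form set \<Rightarrow> form set \<Rightarrow> form \<Rightarrow> bool"
  for G :: form where
  ax_reg:
    "F \<in> PV_bot \<Longrightarrow> F \<in> Sr G \<Longrightarrow> frj_reg G (bar_At G - {F}) F"
| ax_irr:
    "F \<in> PV_bot \<Longrightarrow> F \<in> Sr G \<Longrightarrow> frj_irr G {} ((bar_At G - {F}) \<union> bar_imp G) F"
| and1_reg:
    "frj_reg G \<Gamma> A \<Longrightarrow> A \<^bold>\<and> B \<in> Sr G \<Longrightarrow> frj_reg G \<Gamma> (A \<^bold>\<and> B)"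
| and2_reg:
    "frj_reg G \<Gamma> B \<Longrightarrow> A \<^bold>\<and> B \<in> Sr G \<Longrightarrow> frj_reg G \<Gamma> (A \<^bold>\<and> B)"
| and1_irr:
    "frj_irr G \<Sigma> \<Theta> A \<Longrightarrow> A \<^bold>\<and> B \<in> Sr G \<Longrightarrow> frj_irr G \<Sigma> \<Theta> (A \<^bold>\<and> B)"
| and2_irr:
    "frj_irr G \<Sigma> \<Theta> B \<Longrightarrow> A \<^bold>\<and> B \<in> Sr G \<Longrightarrow> frj_irr G \<Sigma> \<Theta> (A \<^bold>\<and> B)"
| or_irr:
    "frj_irr G \<Sigma>\<^sub>1 \<Theta>\<^sub>1 A \<Longrightarrow> frj_irr G \<Sigma>\<^sub>2 \<Theta>\<^sub>2 B \<Longrightarrow>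
     \<Sigma>\<^sub>1 \<subseteq> \<Sigma>\<^sub>2 \<union> \<Theta>\<^sub>2 \<Longrightarrow> \<Sigma>\<^sub>2 \<subseteq> \<Sigma>\<^sub>1 \<union> \<Theta>\<^sub>1 \<Longrightarrow> A \<^bold>\<or> B \<in> Sr G \<Longrightarrow>
     frj_irr G (\<Sigma>\<^sub>1 \<union> \<Sigma>\<^sub>2) (\<Theta>\<^sub>1 \<inter> \<Theta>\<^sub>2) (A \<^bold>\<or> B)"
| imp_in_reg:
    "frj_reg G \<Gamma> B \<Longrightarrow> A \<in> Cl \<Gamma> \<Longrightarrow> A \<^bold>\<supset> B \<in> Sr G \<Longrightarrow> frj_reg G \<Gamma> (A \<^bold>\<supset> B)"
| imp_in_irr:
    "frj_irr G \<Sigma> (\<Theta> \<union> \<Lambda>) B \<Longrightarrow> \<Theta> \<inter> \<Lambda> = {} \<Longrightarrow> A \<in> Cl (\<Sigma> \<union> \<Lambda>) \<Longrightarrow>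
     (\<forall>\<Lambda>'. \<Lambda>' \<subset> \<Lambda> \<longrightarrow> A \<notin> Cl (\<Sigma> \<union> \<Lambda>')) \<Longrightarrow> A \<^bold>\<supset> B \<in> Sr G \<Longrightarrow>
     frj_irr G (\<Sigma> \<union> \<Lambda>) \<Theta> (A \<^bold>\<supset> B)"
| imp_notin:
    "frj_reg G \<Gamma> B \<Longrightarrow> \<Theta> \<subseteq> Cl \<Gamma> \<inter> bar G \<Longrightarrow> A \<in> Cl \<Gamma> - Cl \<Theta> \<Longrightarrow>
     (\<forall>\<Theta>'. \<Theta> \<subset> \<Theta>' \<and> \<Theta>' \<subseteq> Cl \<Gamma> \<inter> bar G \<longrightarrow> A \<in> Cl \<Theta>') \<Longrightarrow> A \<^bold>\<supset> B \<in> Sr G \<Longrightarrow>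
     frj_irr G {} \<Theta> (A \<^bold>\<supset> B)"
| join_At:
    "join_ok n S T A \<Longrightarrow> (\<forall>j\<in>{1..n}. frj_irr G (S j) (T j) (A j)) \<Longrightarrow>
     F \<in> PV_bot - join_SAt n S \<Longrightarrow>
     (\<forall>Y\<in>join_Ups n A. \<exists>Z. Y \<^bold>\<supset> Z \<in> Sl G) \<Longrightarrow> F \<in> Sr G \<Longrightarrow>
     frj_reg G (join_SAt n S \<union> (join_TAt n T - {F}) \<union> join_Simp n S \<union> join_Timp n T A) F"
| join_or:
    "join_ok n S T A \<Longrightarrow> (\<forall>j\<in>{1..n}. frj_irr G (S j) (T j) (A j)) \<Longrightarrow>
     {C\<^sub>1, C\<^sub>2} \<subseteq> join_Ups n A \<Longrightarrow>
     (\<forall>Y\<in>join_Ups n A. \<exists>Z. Y \<^bold>\<supset> Z \<in> Sl G \<or> Y \<^bold>\<or> Z \<in> Sr G \<or> Z \<^bold>\<or> Y \<in> Sr G) \<Longrightarrow>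
     C\<^sub>1 \<^bold>\<or> C\<^sub>2 \<in> Sr G \<Longrightarrow>
     frj_reg G (join_SAt n S \<union> join_TAt n T \<union> join_Simp n S \<union> join_Timp n T A) (C\<^sub>1 \<^bold>\<or> C\<^sub>2)"

lemma join_subset_bar:
  assumes "join_ok n S T A" and "\<forall>j\<in>{1..n}. S j \<union> T j \<subseteq> bar G"
  shows "join_SAt n S \<union> join_TAt n T \<union> join_Simp n S \<union> join_Timp n T A \<subseteq> bar G"
proof -
  have "1 \<in> {1..n}" using assms(1) by (simp add: join_ok_def)
  then have "join_TAt n T \<subseteq> T 1" "join_Timp n T A \<subseteq> T 1" "T 1 \<subseteq> bar G"
    using assms(2) unfolding join_TAt_def join_Timp_def by auto
  moreover have "join_SAt n S \<subseteq> bar G" "join_Simp n S \<subseteq> bar G"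
    using assms(2) unfolding join_SAt_def join_Simp_def by auto
  ultimately show ?thesis by blast
qed

lemma frj_sequent:
  "frj_reg G \<Gamma> C \<Longrightarrow> \<Gamma> \<subseteq> bar G \<and> C \<in> Sr G"
  "frj_irr G \<Sigma> \<Theta> C \<Longrightarrow> \<Sigma> \<union> \<Theta> \<subseteq> bar G \<and> C \<in> Sr G"
proof (induction rule: frj_reg_frj_irr.inducts)
  case (join_At n S T A F)
  then have "\<forall>j\<in>{1..n}. S j \<union> T j \<subseteq> bar G" by simp
  from join_subset_bar[OF join_At(1) this] join_At(5) show ?case by auto
next
  case (join_or n S T A C\<^sub>1 C\<^sub>2)
  then have "\<forall>j\<in>{1..n}. S j \<union> T j \<subseteq> bar G" by simp
  from join_subset_bar[OF join_or(1) this] join_or(5) show ?case by simp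
qed (auto simp: bar_def)

definition gbu_seq :: "form \<Rightarrow> form set \<Rightarrow> form \<Rightarrow> bool" where
  "gbu_seq G \<Psi> C \<longleftrightarrow> \<Psi> \<subseteq> Sl G \<and> C \<in> Sr G"

text \<open>
  \<open>gbu_reg G \<Psi> C\<close> and \<open>gbu_irr G \<Psi> C\<close> say that the regular and the irregular sequent with
  left set \<open>\<Psi>\<close> and right formula \<open>C\<close> are derivable in \<open>GBU(G)\<close>. It is enough to require
  \<open>gbu_seq\<close> of conclusions, since premises are conclusions of earlier rules. In
  \<open>insert A \<Psi>\<close>, the set \<open>\<Psi>\<close> may already contain \<open>A\<close>.
\<close>

inductive gbu_reg :: "form \<Rightarrow> form set \<Rightarrow> form \<Rightarrow> bool"
  and gbu_irr :: "form \<Rightarrow> form set \<Rightarrow> form \<Rightarrow> bool"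
  for G :: form where
  ax_reg:
    "gbu_seq G (insert A \<Psi>) A \<Longrightarrow> gbu_reg G (insert A \<Psi>) A"
| ax_bot:
    "gbu_seq G (insert \<^bold>\<bottom> \<Psi>) C \<Longrightarrow> gbu_reg G (insert \<^bold>\<bottom> \<Psi>) C"
| ax_irr:
    "gbu_seq G (insert A \<Psi>) A \<Longrightarrow> gbu_irr G (insert A \<Psi>) A"
| L_and:
    "gbu_reg G (insert A (insert B \<Psi>)) C \<Longrightarrow> gbu_seq G (insert (A \<^bold>\<and> B) \<Psi>) C \<Longrightarrow>
     gbu_reg G (insert (A \<^bold>\<and> B) \<Psi>) C"
| R_and_reg:
    "gbu_reg G \<Psi> A \<Longrightarrow> gbu_reg G \<Psi> B \<Longrightarrow> gbu_seq G \<Psi> (A \<^bold>\<and> B) \<Longrightarrow> gbu_reg G \<Psi> (A \<^bold>\<and> B)"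
| R_and_irr:
    "gbu_irr G \<Psi> A \<Longrightarrow> gbu_irr G \<Psi> B \<Longrightarrow> gbu_seq G \<Psi> (A \<^bold>\<and> B) \<Longrightarrow> gbu_irr G \<Psi> (A \<^bold>\<and> B)"
| L_or:
    "gbu_reg G (insert A \<Psi>) C \<Longrightarrow> gbu_reg G (insert B \<Psi>) C \<Longrightarrow>
     gbu_seq G (insert (A \<^bold>\<or> B) \<Psi>) C \<Longrightarrow> gbu_reg G (insert (A \<^bold>\<or> B) \<Psi>) C"
| R_or1_reg:
    "gbu_irr G \<Psi> A \<Longrightarrow> gbu_seq G \<Psi> (A \<^bold>\<or> B) \<Longrightarrow> gbu_reg G \<Psi> (A \<^bold>\<or> B)"
| R_or2_reg:
    "gbu_irr G \<Psi> B \<Longrightarrow> gbu_seq G \<Psi> (A \<^bold>\<or> B) \<Longrightarrow> gbu_reg G \<Psi> (A \<^bold>\<or> B)"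
| R_or1_irr:
    "gbu_irr G \<Psi> A \<Longrightarrow> gbu_seq G \<Psi> (A \<^bold>\<or> B) \<Longrightarrow> gbu_irr G \<Psi> (A \<^bold>\<or> B)"
| R_or2_irr:
    "gbu_irr G \<Psi> B \<Longrightarrow> gbu_seq G \<Psi> (A \<^bold>\<or> B) \<Longrightarrow> gbu_irr G \<Psi> (A \<^bold>\<or> B)"
| L_imp:
    "gbu_irr G (insert (A \<^bold>\<supset> B) \<Psi>) A \<Longrightarrow> gbu_reg G (insert B \<Psi>) C \<Longrightarrow>
     gbu_seq G (insert (A \<^bold>\<supset> B) \<Psi>) C \<Longrightarrow> gbu_reg G (insert (A \<^bold>\<supset> B) \<Psi>) C"
| R_imp_in_reg:
    "gbu_reg G \<Psi> B \<Longrightarrow> A \<in> Cl \<Psi> \<Longrightarrow> gbu_seq G \<Psi> (A \<^bold>\<supset> B) \<Longrightarrow> gbu_reg G \<Psi> (A \<^bold>\<supset> B)"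
| R_imp_in_irr:
    "gbu_irr G \<Psi> B \<Longrightarrow> A \<in> Cl \<Psi> \<Longrightarrow> gbu_seq G \<Psi> (A \<^bold>\<supset> B) \<Longrightarrow> gbu_irr G \<Psi> (A \<^bold>\<supset> B)"
| R_imp_notin_reg:
    "gbu_reg G (insert A \<Psi>) B \<Longrightarrow> A \<notin> Cl \<Psi> \<Longrightarrow> gbu_seq G \<Psi> (A \<^bold>\<supset> B) \<Longrightarrow>
     gbu_reg G \<Psi> (A \<^bold>\<supset> B)"
| R_imp_notin_irr:
    "gbu_reg G (insert A \<Psi>) B \<Longrightarrow> A \<notin> Cl \<Psi> \<Longrightarrow> gbu_seq G \<Psi> (A \<^bold>\<supset> B) \<Longrightarrow>
     gbu_irr G \<Psi> (A \<^bold>\<supset> B)"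

end

theory Submission
  imports Defs
begin

text \<open>
  Two facts give both halves. \<^emph>\<open>Dichotomy:\<close> every sequent over \<open>G\<close> (with \<open>\<Psi> \<subseteq> bar G\<close>
  if it is irregular) is either derivable in \<open>GBU(G)\<close> or refuted by a sequent derivable in \<open>FRJ(G)\<close>; a regular \<open>\<Psi> \<Rightarrow> C\<close> is refuted by
  \<open>\<Gamma> \<Rightarrow> C\<close> with \<open>\<Psi> \<subseteq> Cl \<Gamma>\<close>, an irregular \<open>\<Psi> \<rightarrow> C\<close> by \<open>\<Sigma>; \<Theta> \<rightarrow> C\<close> with
  \<open>\<Sigma> \<subseteq> \<Psi> \<subseteq> \<Sigma> \<union> \<Theta>\<close>. One reads the \<open>GBU\<close> rules upwards: a refutation of a premise yields
  one of the conclusion, and a sequent to which no rule applies is refuted by an axiom or a join.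
  This terminates because \<open>Cl \<Psi>\<close> never shrinks and grows strictly at \<open>\<supset>R\<notin>\<close>, the only
  way back from irregular to regular sequents.
  \<^emph>\<open>Soundness:\<close> \<open>GBU(G)\<close> embeds in \<open>NJ\<close>. The left sides of the regular sequents derivable in
  \<open>FRJ(G)\<close> are the worlds of one Kripke model, ordered by \<open>\<Gamma> \<subseteq> Cl \<Gamma>'\<close>, in which the world \<open>\<Gamma>\<close>
  forces \<open>Cl \<Gamma>\<close> and does not force \<open>C\<close> whenever \<open>\<Gamma> \<Rightarrow> C\<close> is derivable.
\<close>

section \<open>Closure and subformulas\<close>

lemma Cl_superset: "\<Gamma> \<subseteq> Cl \<Gamma>"
  by (auto intro: Cl.intros)

lemma Cl_mono: "\<Gamma> \<subseteq> \<Delta> \<Longrightarrow> Cl \<Gamma> \<subseteq> Cl \<Delta>"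
proof
  fix X assume "\<Gamma> \<subseteq> \<Delta>"
  show "X \<in> Cl \<Delta>" if "X \<in> Cl \<Gamma>"
    using that by induction (use \<open>\<Gamma> \<subseteq> \<Delta>\<close> in \<open>auto intro: Cl.intros\<close>)
qed

text \<open>Closing a second time adds nothing. Hence the relation
  \<open>\<Gamma> \<subseteq> Cl \<Delta>\<close> is transitive and can order the worlds of a Kripke
  model.\<close>

lemma Cl_least:
  assumes "\<Gamma> \<subseteq> Cl \<Delta>"
  shows "Cl \<Gamma> \<subseteq> Cl \<Delta>"
proof
  fix X assume "X \<in> Cl \<Gamma>"
  then show "X \<in> Cl \<Delta>"
    by induction (use assms in \<open>auto intro: Cl.intros\<close>)
qed

section \<open>Finiteness of \<open>Sl G\<close>, on which the extremal choices and the termination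
  measure rest\<close>

fun subforms :: "form \<Rightarrow> form set" where
  "subforms (Var n) = {Var n}"
| "subforms \<^bold>\<bottom> = {\<^bold>\<bottom>}"
| "subforms (A \<^bold>\<and> B) = insert (A \<^bold>\<and> B) (subforms A \<union> subforms B)"
| "subforms (A \<^bold>\<or> B) = insert (A \<^bold>\<or> B) (subforms A \<union> subforms B)"
| "subforms (A \<^bold>\<supset> B) = insert (A \<^bold>\<supset> B) (subforms A \<union> subforms B)"

lemma finite_subforms: "finite (subforms A)"
  by (induction A) auto

lemma subforms_refl: "A \<in> subforms A"
  by (cases A) auto

lemma subforms_trans: "A \<in> subforms B \<Longrightarrow> B \<in> subforms C \<Longrightarrow> A \<in> subforms C"
  by (induction C) auto

lemma Sl_Sr_subforms:
  "X \<in> Sl G \<Longrightarrow> X \<in> subforms G"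
  "X \<in> Sr G \<Longrightarrow> X \<in> subforms G"
proof (induction rule: Sl_Sr.inducts)
qed (auto intro: subforms_refl elim!: subforms_trans[rotated])

lemma finite_Sl: "finite (Sl G)"
  by (rule finite_subset[OF _ finite_subforms[of G]]) (auto dest: Sl_Sr_subforms)

lemma bar_subset_Sl: "bar G \<subseteq> Sl G"
  by (auto simp: bar_def bar_At_def bar_imp_def)

lemma finite_subset_bar: "\<Psi> \<subseteq> bar G \<Longrightarrow> finite \<Psi>"
  by (erule finite_subset[OF _ finite_subset[OF bar_subset_Sl finite_Sl]])

lemma finite_gbu_seq: "gbu_seq G \<Psi> C \<Longrightarrow> finite \<Psi>"
  unfolding gbu_seq_def by (blast intro: finite_subset[OF _ finite_Sl])

lemma not_in_bar [simp]: "\<^bold>\<bottom> \<notin> bar G" "A \<^bold>\<and> B \<notin> bar G" "A \<^bold>\<or> B \<notin> bar G"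
  by (auto simp: bar_def bar_At_def bar_imp_def PV_def L_imp_def)

lemma PV_simps [simp]:
  "Var n \<in> PV" "\<^bold>\<bottom> \<notin> PV" "A \<^bold>\<and> B \<notin> PV" "A \<^bold>\<or> B \<notin> PV" "A \<^bold>\<supset> B \<notin> PV"
  by (auto simp: PV_def)

lemma L_imp_simps [simp]:
  "Var n \<notin> L_imp" "\<^bold>\<bottom> \<notin> L_imp" "A \<^bold>\<and> B \<notin> L_imp" "A \<^bold>\<or> B \<notin> L_imp" "A \<^bold>\<supset> B \<in> L_imp"
  by (auto simp: L_imp_def)

section \<open>Soundness of GBU\<close>

lemma nj_weaken: "nj \<Gamma> A \<Longrightarrow> \<Gamma> \<subseteq> \<Delta> \<Longrightarrow> nj \<Delta> A"
proof (induction arbitrary: \<Delta> rule: nj.induct)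
  case (orE \<Gamma> A B C)
  then show ?case by (meson insert_mono nj.orE)
next
  case (impI A \<Gamma> B)
  then show ?case by (meson insert_mono nj.impI)
qed (blast intro: nj.intros)+

lemma nj_cut: "nj \<Gamma> A \<Longrightarrow> nj (insert A \<Gamma>) C \<Longrightarrow> nj \<Gamma> C"
  by (blast intro: nj.impI nj.impE)

text \<open>Each rule is sound for \<open>nj\<close> once both kinds of sequent are identified. A
  premise of a left rule may lack the principal formula, so it is weakened before the cut or the
  disjunction elimination.\<close>

lemma gbu_sound:
  "gbu_reg G \<Psi> C \<Longrightarrow> nj \<Psi> C"
  "gbu_irr G \<Psi> C \<Longrightarrow> nj \<Psi> C"
proof (induction rule: gbu_reg_gbu_irr.inducts)
  case (L_and A B \<Psi> C)
  let ?\<Psi> = "insert (A \<^bold>\<and> B) \<Psi>"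
  have AB: "nj ?\<Psi> (A \<^bold>\<and> B)" by (blast intro: nj.ass)
  have "nj (insert A (insert B ?\<Psi>)) C" by (rule nj_weaken[OF L_and(2)]) blast
  moreover have "nj (insert B ?\<Psi>) A" by (rule nj_weaken[OF nj.andE1[OF AB]]) blast
  ultimately have "nj (insert B ?\<Psi>) C" by (rule nj_cut[rotated])
  with nj.andE2[OF AB] show ?case by (rule nj_cut)
next
  case (L_or A \<Psi> C B)
  let ?\<Psi> = "insert (A \<^bold>\<or> B) \<Psi>"
  have "nj ?\<Psi> (A \<^bold>\<or> B)" by (blast intro: nj.ass)
  moreover have "nj (insert A ?\<Psi>) C" by (rule nj_weaken[OF L_or(2)]) blast
  moreover have "nj (insert B ?\<Psi>) C" by (rule nj_weaken[OF L_or(4)]) blast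
  ultimately show ?case by (rule nj.orE)
next
  case (L_imp A B \<Psi> C)
  let ?\<Psi> = "insert (A \<^bold>\<supset> B) \<Psi>"
  have "nj ?\<Psi> B" using L_imp(2) by (blast intro: nj.ass nj.impE)
  moreover have "nj (insert B ?\<Psi>) C" by (rule nj_weaken[OF L_imp(4)]) blast
  ultimately show ?case by (rule nj_cut)
qed (auto intro: nj.intros nj_weaken)

section \<open>Soundness of FRJ\<close>

text \<open>The right formula is forgotten: one left set can refute several formulas and still
  counts as a single world.\<close>

definition world :: "form \<Rightarrow> form set \<Rightarrow> bool" where
  "world G \<Gamma> \<longleftrightarrow> (\<exists>C. frj_reg G \<Gamma> C)"

fun forces :: "form \<Rightarrow> form set \<Rightarrow> form \<Rightarrow> bool" where
  "forces G \<Gamma> (Var n) \<longleftrightarrow> Var n \<in> \<Gamma>"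
| "forces G \<Gamma> \<^bold>\<bottom> \<longleftrightarrow> False"
| "forces G \<Gamma> (A \<^bold>\<and> B) \<longleftrightarrow> forces G \<Gamma> A \<and> forces G \<Gamma> B"
| "forces G \<Gamma> (A \<^bold>\<or> B) \<longleftrightarrow> forces G \<Gamma> A \<or> forces G \<Gamma> B"
| "forces G \<Gamma> (A \<^bold>\<supset> B) \<longleftrightarrow>
     (\<forall>\<Delta>. world G \<Delta> \<and> \<Gamma> \<subseteq> Cl \<Delta> \<and> forces G \<Delta> A \<longrightarrow> forces G \<Delta> B)"

text \<open>No closure rule produces a variable, so forced variables persist along the order of
  worlds.\<close>

lemma Cl_Var_iff [simp]: "Var n \<in> Cl \<Gamma> \<longleftrightarrow> Var n \<in> \<Gamma>"
  by (auto intro: Cl.intros elim: Cl.cases)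

lemma forces_mono: "forces G \<Gamma> A \<Longrightarrow> \<Gamma> \<subseteq> Cl \<Delta> \<Longrightarrow> forces G \<Delta> A"
proof (induction A arbitrary: \<Gamma> \<Delta>)
  case (Imp A B)
  then show ?case using Cl_least by (simp, blast)
qed auto

lemma nj_forces:
  "nj \<Phi> C \<Longrightarrow> world G \<Gamma> \<Longrightarrow> \<forall>X\<in>\<Phi>. forces G \<Gamma> X \<Longrightarrow> forces G \<Gamma> C"
proof (induction arbitrary: \<Gamma> rule: nj.induct)
  case (impI A \<Phi> B)
  then show ?case by (auto intro: forces_mono)
next
  case (impE \<Phi> A B)
  \<comment> \<open>Reflexivity of the order lets the implication be applied at
    \<open>\<Gamma>\<close> itself.\<close>
  have "\<Gamma> \<subseteq> Cl \<Gamma>" by (rule Cl_superset)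
  moreover have "forces G \<Gamma> (A \<^bold>\<supset> B)" "forces G \<Gamma> A" using impE by blast+
  ultimately show ?case using impE.prems(1) by simp
next
  case (orE \<Phi> A B C)
  then show ?case by fastforce
qed auto

text \<open>The compatibility condition in \<open>join_ok\<close> puts every \<open>S i\<close>
  inside \<open>S j \<union> T j\<close>, and the \<open>T\<close> parts are intersections. So each
  premise speaks about the world that the join concludes.\<close>

lemma join_between:
  assumes "join_ok n S T A" "\<forall>j\<in>{1..n}. frj_irr G (S j) (T j) (A j)" "j \<in> {1..n}"
    and \<Gamma>: "\<Gamma> = join_SAt n S \<union> (join_TAt n T - {F}) \<union> join_Simp n S \<union> join_Timp n T A"
  shows "S j \<subseteq> \<Gamma>" "\<Gamma> \<subseteq> S j \<union> T j"
proof -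
  have "S j \<subseteq> bar G" using frj_sequent(2) assms(2,3) by blast
  moreover have "bar G \<subseteq> PV \<union> L_imp" by (auto simp: bar_def bar_At_def bar_imp_def)
  ultimately show "S j \<subseteq> \<Gamma>"
    using assms(3) by (auto simp: \<Gamma> join_SAt_def join_Simp_def)
  have "S i \<subseteq> S j \<union> T j" if "i \<in> {1..n}" for i
    using assms(1,3) that by (cases "i = j") (auto simp: join_ok_def)
  then show "\<Gamma> \<subseteq> S j \<union> T j"
    using assms(3) unfolding \<Gamma> join_SAt_def join_Simp_def join_TAt_def join_Timp_def by blast
qed

text \<open>Implications enter the left side of a regular sequent only at a join, which forces their
  antecedents to be right formulas of premises. The other regular rules are axioms with atoms only
  or keep the left side.\<close>

lemma world_imp_premise:
  assumes "frj_reg G \<Gamma> C" "Y \<^bold>\<supset> Z \<in> \<Gamma>"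
  obtains \<Sigma> \<Theta> where "frj_irr G \<Sigma> \<Theta> Y" "\<Sigma> \<subseteq> \<Gamma>" "\<Gamma> \<subseteq> \<Sigma> \<union> \<Theta>"
proof -
  have "\<exists>\<Sigma> \<Theta>. frj_irr G \<Sigma> \<Theta> Y \<and> \<Sigma> \<subseteq> \<Gamma> \<and> \<Gamma> \<subseteq> \<Sigma> \<union> \<Theta>"
    using assms
  \<comment> \<open>The predicate for irregular sequents is trivial: a join needs only the
    derivability of its premises.\<close>
  proof (induction \<Gamma> C rule: frj_reg_frj_irr.inducts(1)[where ?P2.0 = "\<lambda>_ _ _. True"])
    case (join_At n S T A F)
    have "Y \<in> join_Ups n A"
      using join_At(1,6) by (auto simp: join_ok_def join_SAt_def join_TAt_def join_Timp_def)
    then obtain j where j: "j \<in> {1..n}" "Y = A j" by (auto simp: join_Ups_def)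
    moreover have "\<forall>j\<in>{1..n}. frj_irr G (S j) (T j) (A j)" using join_At by blast
    moreover note join_between[OF join_At(1) this j(1) refl, of F]
    ultimately show ?case by blast
  next
    case (join_or n S T A C\<^sub>1 C\<^sub>2)
    have "Y \<in> join_Ups n A"
      using join_or(1,6) by (auto simp: join_ok_def join_SAt_def join_TAt_def join_Timp_def)
    then obtain j where j: "j \<in> {1..n}" "Y = A j" by (auto simp: join_Ups_def)
    have irr: "\<forall>j\<in>{1..n}. frj_irr G (S j) (T j) (A j)" using join_or by blast
    \<comment> \<open>Since \<open>n\<close> is at least 1, the intersection consists of variables.
      Removing \<bottom> changes nothing and gives the shape of \<open>join_between\<close>.\<close>
    have "join_TAt n T = join_TAt n T - {\<^bold>\<bottom>}"
      using join_or(1) by (auto simp: join_TAt_def join_ok_def)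
    with join_between[OF join_or(1) irr j(1) refl, of "\<^bold>\<bottom>"] have
      "S j \<subseteq> join_SAt n S \<union> join_TAt n T \<union> join_Simp n S \<union> join_Timp n T A"
      "join_SAt n S \<union> join_TAt n T \<union> join_Simp n S \<union> join_Timp n T A \<subseteq> S j \<union> T j"
      by metis+
    with irr j show ?case by blast
  qed (auto simp: bar_At_def)
  with that show thesis by blast
qed

text \<open>The three claims feed each other on smaller formulas: forcing an implication uses that
  its antecedent is refuted by an irregular sequent, and refuting one uses that an antecedent in a
  closure is forced. The worlds above \<open>\<Gamma>\<close> may come from unrelated derivations,
  hence the induction on formula size.\<close>

lemma forces_world:
  "(world G \<Gamma> \<longrightarrow> X \<in> Cl \<Gamma> \<longrightarrow> forces G \<Gamma> X) \<and>
   (frj_reg G \<Gamma> X \<longrightarrow> \<not> forces G \<Gamma> X) \<and>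
   (frj_irr G \<Sigma> \<Theta> X \<longrightarrow> world G \<Gamma> \<longrightarrow> \<Sigma> \<subseteq> \<Gamma> \<longrightarrow> \<Gamma> \<subseteq> \<Sigma> \<union> \<Theta> \<longrightarrow> \<not> forces G \<Gamma> X)"
proof (induction X arbitrary: \<Gamma> \<Sigma> \<Theta> rule: measure_induct_rule[where f = size])
  case (less X)
  have cl: "forces G \<Delta> Y" if "size Y < size X" "world G \<Delta>" "Y \<in> Cl \<Delta>" for Y \<Delta>
    using less.IH that by blast
  have reg: "\<not> forces G \<Delta> Y" if "size Y < size X" "frj_reg G \<Delta> Y" for Y \<Delta>
    using less.IH that by blast
  have irr: "\<not> forces G \<Delta> Y"
    if "size Y < size X" "frj_irr G \<Sigma> \<Theta> Y" "world G \<Delta>" "\<Sigma> \<subseteq> \<Delta>" "\<Delta> \<subseteq> \<Sigma> \<union> \<Theta>" for Y \<Delta> \<Sigma> \<Theta>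
    using less.IH that by blast
  have "forces G \<Gamma> X" if "world G \<Gamma>" "X \<in> Cl \<Gamma>"
  proof (cases X)
    case (Var n)
    then show ?thesis using that by simp
  next
    \<comment> \<open>Worlds lie in \<open>bar G\<close>, so \<bottom>, conjunctions and
      disjunctions could be in \<open>Cl \<Gamma>\<close> only through a closure rule.\<close>
    case Bot
    then have "\<^bold>\<bottom> \<in> \<Gamma>" using that by (auto elim: Cl.cases)
    then show ?thesis using that frj_sequent(1) not_in_bar(1) unfolding world_def by blast
  next
    case (And A B)
    then have "A \<^bold>\<and> B \<notin> \<Gamma>" using that frj_sequent(1) not_in_bar(2) unfolding world_def by blast
    then have "A \<in> Cl \<Gamma>" "B \<in> Cl \<Gamma>" using that And by (auto elim: Cl.cases)
    then show ?thesis using cl And that by simp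
  next
    case (Or A B)
    then have "A \<^bold>\<or> B \<notin> \<Gamma>" using that frj_sequent(1) not_in_bar(3) unfolding world_def by blast
    then have "A \<in> Cl \<Gamma> \<or> B \<in> Cl \<Gamma>" using that Or by (auto elim: Cl.cases)
    then show ?thesis using cl Or that by auto
  next
    case (Imp Y Z)
    have "forces G \<Delta> Z" if \<Delta>: "world G \<Delta>" "\<Gamma> \<subseteq> Cl \<Delta>" "forces G \<Delta> Y" for \<Delta>
    proof -
      have "Y \<^bold>\<supset> Z \<in> Cl \<Delta>" using Cl_least[OF \<Delta>(2)] \<open>X \<in> Cl \<Gamma>\<close> Imp by blast
      \<comment> \<open>In the first case a join premise refutes \<open>Y\<close> at
        \<open>\<Delta>\<close>, against the assumption; in the second the induction hypothesis
        forces \<open>Z\<close>.\<close>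
      then consider "Y \<^bold>\<supset> Z \<in> \<Delta>" | "Z \<in> Cl \<Delta>" by (auto elim: Cl.cases)
      then show ?thesis
      proof cases
        case 1
        obtain C where "frj_reg G \<Delta> C" using \<Delta>(1) by (auto simp: world_def)
        then obtain \<Sigma> \<Theta> where "frj_irr G \<Sigma> \<Theta> Y" "\<Sigma> \<subseteq> \<Delta>" "\<Delta> \<subseteq> \<Sigma> \<union> \<Theta>"
          using world_imp_premise 1 by blast
        with irr \<Delta> Imp show ?thesis by simp
      next
        case 2
        then show ?thesis using cl \<Delta> Imp by simp
      qed
    qed
    then show ?thesis using Imp by simp
  qed
  moreover have "\<not> forces G \<Gamma> X" if r: "frj_reg G \<Gamma> X"
  proof -
    have w: "world G \<Gamma>" using r by (auto simp: world_def)
    from r show ?thesis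
    proof cases
      case (imp_in_reg B A)
      then have "forces G \<Gamma> A" "\<not> forces G \<Gamma> B" using cl reg w by simp_all
      moreover have "\<Gamma> \<subseteq> Cl \<Gamma>" by (rule Cl_superset)
      ultimately show ?thesis using imp_in_reg(1) w by auto
    next
      case (join_or n S T A C1 C2)
      have "join_TAt n T = join_TAt n T - {\<^bold>\<bottom>}"
        using join_or(3) by (auto simp: join_TAt_def join_ok_def)
      with join_or(1) have
        \<Gamma>: "\<Gamma> = join_SAt n S \<union> (join_TAt n T - {\<^bold>\<bottom>}) \<union> join_Simp n S \<union> join_Timp n T A"
        by simp
      have "\<not> forces G \<Gamma> Y" if Y: "Y \<in> join_Ups n A" "size Y < size X" for Y
      proof -
        obtain j where j: "j \<in> {1..n}" "Y = A j" using Y(1) by (auto simp: join_Ups_def)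
        have "frj_irr G (S j) (T j) Y" using join_or(4) j by blast
        with irr[OF Y(2) this w] join_between[OF join_or(3,4) j(1) \<Gamma>] show ?thesis by blast
      qed
      moreover have "size C1 < size X" "size C2 < size X" using join_or by auto
      ultimately show ?thesis using join_or(2,5) by auto
    next
      case (join_At n S T A)
      then show ?thesis
        by (auto simp: PV_bot_def PV_def join_Simp_def join_Timp_def)
    qed (use reg in \<open>auto simp: PV_bot_def PV_def\<close>)
  qed
  moreover have "\<not> forces G \<Gamma> X"
    if i: "frj_irr G \<Sigma> \<Theta> X" and w: "world G \<Gamma>" and \<Gamma>: "\<Sigma> \<subseteq> \<Gamma>" "\<Gamma> \<subseteq> \<Sigma> \<union> \<Theta>"
    using i
  proof cases
    case ax_irr
    have "X \<in> PV_bot" using ax_irr by blast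
    then consider n where "X = Var n" | "X = \<^bold>\<bottom>" by (auto simp: PV_bot_def PV_def)
    then show ?thesis
    proof cases
      case (1 n)
      have "X \<notin> \<Sigma> \<union> \<Theta>" using ax_irr 1 by (simp add: bar_imp_def)
      then show ?thesis using \<Gamma> 1 by auto
    qed simp
  next
    case (and1_irr A B)
    then show ?thesis using irr w \<Gamma> by auto
  next
    case (and2_irr B A)
    then show ?thesis using irr w \<Gamma> by auto
  next
    case (or_irr \<Sigma>1 \<Theta>1 A \<Sigma>2 \<Theta>2 B)
    \<comment> \<open>The two inclusions between the premises keep \<open>\<Gamma>\<close> inside
      the interval of each of them.\<close>
    then have "\<not> forces G \<Gamma> A" using \<Gamma> by (intro irr[OF _ or_irr(4) w]) auto
    moreover have "\<not> forces G \<Gamma> B" using \<Gamma> or_irr by (intro irr[OF _ or_irr(5) w]) auto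
    ultimately show ?thesis using or_irr by simp
  next
    case (imp_in_irr \<Sigma>' \<Lambda> B A)
    have "A \<in> Cl \<Gamma>" using imp_in_irr Cl_mono \<Gamma>(1) by blast
    then have "forces G \<Gamma> A" using cl w imp_in_irr by simp
    moreover have "\<not> forces G \<Gamma> B" using imp_in_irr \<Gamma> by (intro irr[OF _ imp_in_irr(3) w]) auto
    moreover have "\<Gamma> \<subseteq> Cl \<Gamma>" by (rule Cl_superset)
    ultimately show ?thesis using imp_in_irr w by auto
  next
    case (imp_notin \<Delta> B A)
    \<comment> \<open>The refuting world is the left side of the regular premise. It is above
      \<open>\<Gamma>\<close> because \<open>\<Sigma>\<close> is empty and
      \<open>\<Theta> \<subseteq> Cl \<Delta>\<close>.\<close>
    have "world G \<Delta>" using imp_notin by (auto simp: world_def)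
    moreover have "forces G \<Delta> A" using cl calculation imp_notin by simp
    moreover have "\<not> forces G \<Delta> B" using reg imp_notin by simp
    moreover have "\<Gamma> \<subseteq> Cl \<Delta>" using \<Gamma> imp_notin by auto
    ultimately show ?thesis using imp_notin(2) by auto
  qed
  ultimately show ?case by blast
qed

lemma frj_sound: "frj_reg G \<Gamma> C \<Longrightarrow> C \<notin> IPL"
  using nj_forces[of "{}" C G \<Gamma>] forces_world[of G \<Gamma> C] by (auto simp: IPL_def world_def)

section \<open>Refutations\<close>

definition refuted_reg :: "form \<Rightarrow> form set \<Rightarrow> form \<Rightarrow> bool" where
  "refuted_reg G \<Psi> C \<longleftrightarrow> (\<exists>\<Gamma>. frj_reg G \<Gamma> C \<and> \<Psi> \<subseteq> Cl \<Gamma>)"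

definition refuted_irr :: "form \<Rightarrow> form set \<Rightarrow> form \<Rightarrow> bool" where
  "refuted_irr G \<Psi> C \<longleftrightarrow> (\<exists>\<Sigma> \<Theta>. frj_irr G \<Sigma> \<Theta> C \<and> \<Sigma> \<subseteq> \<Psi> \<and> \<Psi> \<subseteq> \<Sigma> \<union> \<Theta>)"

text \<open>Carries a refutation from a premise down to a conclusion whose left side lies in the
  closure of that of the premise.\<close>

lemma refuted_reg_antimono: "refuted_reg G \<Psi> C \<Longrightarrow> \<Phi> \<subseteq> Cl \<Psi> \<Longrightarrow> refuted_reg G \<Phi> C"
  unfolding refuted_reg_def using Cl_least by blast

lemma refuted_reg_imp:
  "refuted_reg G \<Psi> B \<Longrightarrow> A \<in> Cl \<Psi> \<Longrightarrow> A \<^bold>\<supset> B \<in> Sr G \<Longrightarrow> refuted_reg G \<Psi> (A \<^bold>\<supset> B)"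
  unfolding refuted_reg_def using Cl_least by (blast intro: frj_reg_frj_irr.imp_in_reg)

text \<open>Both intervals contain \<open>\<Psi>\<close>, which yields the side conditions of the
  disjunction rule.\<close>

lemma refuted_irr_or:
  assumes "refuted_irr G \<Psi> A" "refuted_irr G \<Psi> B" "A \<^bold>\<or> B \<in> Sr G"
  shows "refuted_irr G \<Psi> (A \<^bold>\<or> B)"
proof -
  obtain \<Sigma>1 \<Theta>1 \<Sigma>2 \<Theta>2 where
    1: "frj_irr G \<Sigma>1 \<Theta>1 A" "\<Sigma>1 \<subseteq> \<Psi>" "\<Psi> \<subseteq> \<Sigma>1 \<union> \<Theta>1" and
    2: "frj_irr G \<Sigma>2 \<Theta>2 B" "\<Sigma>2 \<subseteq> \<Psi>" "\<Psi> \<subseteq> \<Sigma>2 \<union> \<Theta>2"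
    using assms unfolding refuted_irr_def by blast
  have "frj_irr G (\<Sigma>1 \<union> \<Sigma>2) (\<Theta>1 \<inter> \<Theta>2) (A \<^bold>\<or> B)"
    using 1 2 assms(3) by (intro frj_reg_frj_irr.or_irr) auto
  then show ?thesis unfolding refuted_irr_def using 1 2
    by (intro exI[of _ "\<Sigma>1 \<union> \<Sigma>2"] exI[of _ "\<Theta>1 \<inter> \<Theta>2"]) auto
qed

text \<open>A minimal \<open>\<Lambda> \<subseteq> \<Psi> \<inter> \<Theta>\<close> that brings
  \<open>A\<close> into the closure satisfies the minimality condition of the rule, and moving it
  from \<open>\<Theta>\<close> to \<open>\<Sigma>\<close> keeps \<open>\<Psi>\<close> in the
  interval.\<close>

lemma refuted_irr_imp_in:
  assumes "refuted_irr G \<Psi> B" "A \<in> Cl \<Psi>" "A \<^bold>\<supset> B \<in> Sr G" "finite \<Psi>"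
  shows "refuted_irr G \<Psi> (A \<^bold>\<supset> B)"
proof -
  obtain \<Sigma> \<Theta> where st: "frj_irr G \<Sigma> \<Theta> B" "\<Sigma> \<subseteq> \<Psi>" "\<Psi> \<subseteq> \<Sigma> \<union> \<Theta>"
    using assms unfolding refuted_irr_def by blast
  define L where "L = {\<Lambda>. \<Lambda> \<subseteq> \<Psi> \<inter> \<Theta> \<and> A \<in> Cl (\<Sigma> \<union> \<Lambda>)}"
  have "\<Sigma> \<union> (\<Psi> \<inter> \<Theta>) = \<Psi>" using st by blast
  then have "\<Psi> \<inter> \<Theta> \<in> L" using assms(2) by (simp add: L_def)
  moreover have "finite L" using assms(4) by (simp add: L_def)
  ultimately obtain \<Lambda> where "\<Lambda> \<in> L" and min: "\<forall>\<Lambda>'\<in>L. \<Lambda>' \<subseteq> \<Lambda> \<longrightarrow> \<Lambda> = \<Lambda>'"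
    using finite_has_minimal2[of L "\<Psi> \<inter> \<Theta>"] by metis
  then have \<Lambda>: "\<Lambda> \<subseteq> \<Psi> \<inter> \<Theta>" "A \<in> Cl (\<Sigma> \<union> \<Lambda>)" by (simp_all add: L_def)
  have "frj_irr G (\<Sigma> \<union> \<Lambda>) (\<Theta> - \<Lambda>) (A \<^bold>\<supset> B)"
  proof (rule frj_reg_frj_irr.imp_in_irr)
    have "(\<Theta> - \<Lambda>) \<union> \<Lambda> = \<Theta>" using \<Lambda>(1) by blast
    then show "frj_irr G \<Sigma> ((\<Theta> - \<Lambda>) \<union> \<Lambda>) B" using st(1) by simp
    show "\<forall>\<Lambda>'. \<Lambda>' \<subset> \<Lambda> \<longrightarrow> A \<notin> Cl (\<Sigma> \<union> \<Lambda>')"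
      using min \<Lambda>(1) unfolding L_def by blast
  qed (use \<Lambda>(2) assms(3) in auto)
  then show ?thesis unfolding refuted_irr_def using st \<Lambda>(1)
    by (intro exI[of _ "\<Sigma> \<union> \<Lambda>"] exI[of _ "\<Theta> - \<Lambda>"]) auto
qed

text \<open>\<open>\<Psi>\<close> lies in \<open>Cl \<Gamma> \<inter> bar G\<close> and its closure
  misses \<open>A\<close>. Extending it to a maximal such \<open>\<Theta>\<close> gives the
  maximality condition of the rule.\<close>

lemma refuted_irr_imp_notin:
  assumes "refuted_reg G (insert A \<Psi>) B" "A \<notin> Cl \<Psi>" "A \<^bold>\<supset> B \<in> Sr G" "\<Psi> \<subseteq> bar G"
  shows "refuted_irr G \<Psi> (A \<^bold>\<supset> B)"
proof -
  obtain \<Gamma> where \<Gamma>: "frj_reg G \<Gamma> B" "insert A \<Psi> \<subseteq> Cl \<Gamma>"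
    using assms unfolding refuted_reg_def by blast
  define T where "T = {\<Theta>. \<Theta> \<subseteq> Cl \<Gamma> \<inter> bar G \<and> A \<notin> Cl \<Theta>}"
  have "T \<subseteq> Pow (Sl G)" using bar_subset_Sl[of G] by (auto simp: T_def)
  then have "finite T" using finite_Sl finite_subset by blast
  moreover have "\<Psi> \<in> T" using \<Gamma> assms by (simp add: T_def)
  ultimately obtain \<Theta> where "\<Theta> \<in> T" and \<Psi>: "\<Psi> \<subseteq> \<Theta>"
    and max: "\<forall>\<Theta>'\<in>T. \<Theta> \<subseteq> \<Theta>' \<longrightarrow> \<Theta> = \<Theta>'"
    using finite_has_maximal2[of T \<Psi>] by metis
  then have \<Theta>: "\<Theta> \<subseteq> Cl \<Gamma> \<inter> bar G" "A \<notin> Cl \<Theta>" by (simp_all add: T_def)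
  have "frj_irr G {} \<Theta> (A \<^bold>\<supset> B)"
  proof (rule frj_reg_frj_irr.imp_notin[OF \<Gamma>(1) \<Theta>(1)])
    show "\<forall>\<Theta>'. \<Theta> \<subset> \<Theta>' \<and> \<Theta>' \<subseteq> Cl \<Gamma> \<inter> bar G \<longrightarrow> A \<in> Cl \<Theta>'"
      using max unfolding T_def by blast
  qed (use \<Gamma>(2) \<Theta>(2) assms(3) in auto)
  with \<Psi> show ?thesis unfolding refuted_irr_def by blast
qed

text \<open>All premises have \<open>\<Psi>\<close> in their intervals, which makes them compatible.
  The bound on \<open>join_SAt\<close> serves to show that an atom outside \<open>\<Psi>\<close> is
  a legal right formula of the join.\<close>

lemma refuted_join:
  assumes "finite \<Upsilon>" "\<Upsilon> \<noteq> {}" "\<forall>Y\<in>\<Upsilon>. refuted_irr G \<Psi> Y"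
    and "\<forall>Y Z. Y \<^bold>\<supset> Z \<in> \<Psi> \<longrightarrow> Y \<in> \<Upsilon>" "\<Psi> \<subseteq> bar G"
  obtains n S T A where "join_ok n S T A" "\<forall>j\<in>{1..n}. frj_irr G (S j) (T j) (A j)"
    "join_Ups n A = \<Upsilon>" "join_SAt n S \<subseteq> \<Psi>"
    "\<Psi> \<subseteq> join_SAt n S \<union> join_TAt n T \<union> join_Simp n S \<union> join_Timp n T A"
proof -
  obtain A where "bij_betw A {1..card \<Upsilon>} \<Upsilon>"
    using ex_bij_betw_nat_finite_1[OF assms(1)] by blast
  then have A: "A ` {1..card \<Upsilon>} = \<Upsilon>" by (simp add: bij_betw_def)
  then have "\<forall>j\<in>{1..card \<Upsilon>}. \<exists>\<Sigma> \<Theta>. frj_irr G \<Sigma> \<Theta> (A j) \<and> \<Sigma> \<subseteq> \<Psi> \<and> \<Psi> \<subseteq> \<Sigma> \<union> \<Theta>"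
    using assms(3) unfolding refuted_irr_def by blast
  then obtain S T where
    ST: "\<And>j. j \<in> {1..card \<Upsilon>} \<Longrightarrow> frj_irr G (S j) (T j) (A j) \<and> S j \<subseteq> \<Psi> \<and> \<Psi> \<subseteq> S j \<union> T j"
    by metis
  have "1 \<le> card \<Upsilon>" using assms(1,2) by (simp add: Suc_le_eq card_gt_0_iff)
  then have "join_ok (card \<Upsilon>) S T A"
    using ST assms(4) A unfolding join_ok_def join_Simp_def join_Ups_def by blast
  moreover have "\<forall>j\<in>{1..card \<Upsilon>}. frj_irr G (S j) (T j) (A j)" using ST by blast
  moreover have "join_Ups (card \<Upsilon>) A = \<Upsilon>" using A by (simp add: join_Ups_def)
  moreover have "join_SAt (card \<Upsilon>) S \<subseteq> \<Psi>" using ST unfolding join_SAt_def by blast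
  moreover have "\<Psi> \<subseteq> join_SAt (card \<Upsilon>) S \<union> join_TAt (card \<Upsilon>) T \<union> join_Simp (card \<Upsilon>) S \<union>
    join_Timp (card \<Upsilon>) T A" (is "_ \<subseteq> ?\<Gamma>")
  proof
    fix X assume "X \<in> \<Psi>"
    \<comment> \<open>So \<open>X\<close> is in some \<open>S j\<close> or in all
      \<open>T j\<close>. In the latter case an implication survives because its antecedent is in
      \<open>\<Upsilon>\<close>.\<close>
    have X: "X \<in> S j \<union> T j" if "j \<in> {1..card \<Upsilon>}" for j using ST \<open>X \<in> \<Psi>\<close> that by blast
    show "X \<in> ?\<Gamma>"
    proof (cases X)
      case (Var n)
      then have "X \<in> PV" by simp
      then show ?thesis using X unfolding join_SAt_def join_TAt_def by blast
    next
      case (Imp Y Z)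
      then have "X \<in> L_imp" "Y \<in> join_Ups (card \<Upsilon>) A"
        using \<open>X \<in> \<Psi>\<close> assms(4) A by (auto simp: join_Ups_def)
      then show ?thesis using X Imp unfolding join_Simp_def join_Timp_def by blast
    qed (use \<open>X \<in> \<Psi>\<close> assms(5) in auto)
  qed
  ultimately show thesis by (rule that)
qed

lemma finite_antecedents: "finite \<Psi> \<Longrightarrow> finite {Y. \<exists>Z. Y \<^bold>\<supset> Z \<in> \<Psi>}"
  by (erule finite_surj[where f = "\<lambda>X. case X of Imp Y Z \<Rightarrow> Y | _ \<Rightarrow> X"])
    (auto intro: rev_image_eqI)

text \<open>A join needs at least one premise, so if \<open>\<Psi>\<close> contains no implication
  an axiom is used instead. Otherwise the premises refute exactly the antecedents in
  \<open>\<Psi>\<close>.\<close>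

lemma refuted_reg_atom:
  assumes "F \<in> PV_bot" "F \<in> Sr G" "F \<notin> \<Psi>" "\<Psi> \<subseteq> bar G"
    and "\<forall>Y Z. Y \<^bold>\<supset> Z \<in> \<Psi> \<longrightarrow> refuted_irr G \<Psi> Y"
  shows "refuted_reg G \<Psi> F"
proof (cases "\<exists>Y Z. Y \<^bold>\<supset> Z \<in> \<Psi>")
  case False
  then have "\<Psi> \<subseteq> bar_At G - {F}"
    using assms(3,4) by (auto simp: bar_def bar_imp_def L_imp_def)
  then show ?thesis unfolding refuted_reg_def
    using assms(1,2) by (blast intro: frj_reg_frj_irr.ax_reg Cl_superset[THEN subsetD])
next
  case True
  let ?U = "{Y. \<exists>Z. Y \<^bold>\<supset> Z \<in> \<Psi>}"
  have "finite \<Psi>" using assms(4) by (rule finite_subset_bar)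
  note ant = finite_antecedents[OF this]
  obtain n S T A where j: "join_ok n S T A" "\<forall>j\<in>{1..n}. frj_irr G (S j) (T j) (A j)"
    "join_Ups n A = ?U" "join_SAt n S \<subseteq> \<Psi>"
    "\<Psi> \<subseteq> join_SAt n S \<union> join_TAt n T \<union> join_Simp n S \<union> join_Timp n T A"
  proof (rule refuted_join[of ?U G \<Psi>])
    show "finite ?U" by (fact ant)
  qed (use True assms(4,5) in blast)+
  have "\<forall>Y\<in>join_Ups n A. \<exists>Z. Y \<^bold>\<supset> Z \<in> Sl G"
    using j(3) assms(4) bar_subset_Sl by blast
  with j assms have
    "frj_reg G (join_SAt n S \<union> (join_TAt n T - {F}) \<union> join_Simp n S \<union> join_Timp n T A) F"
    by (intro frj_reg_frj_irr.join_At) auto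
  moreover have "\<Psi> \<subseteq> join_SAt n S \<union> (join_TAt n T - {F}) \<union> join_Simp n S \<union> join_Timp n T A"
    using j(5) assms(3) by blast
  ultimately show ?thesis unfolding refuted_reg_def by (blast intro: Cl_superset[THEN subsetD])
qed

text \<open>The two disjuncts join the antecedents as premises, so there is always a
  premise.\<close>

lemma refuted_reg_or:
  assumes "C \<^bold>\<or> D \<in> Sr G" "\<Psi> \<subseteq> bar G" "refuted_irr G \<Psi> C" "refuted_irr G \<Psi> D"
    and "\<forall>Y Z. Y \<^bold>\<supset> Z \<in> \<Psi> \<longrightarrow> refuted_irr G \<Psi> Y"
  shows "refuted_reg G \<Psi> (C \<^bold>\<or> D)"
proof -
  let ?U = "{C, D} \<union> {Y. \<exists>Z. Y \<^bold>\<supset> Z \<in> \<Psi>}"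
  have "finite \<Psi>" using assms(2) by (rule finite_subset_bar)
  note ant = finite_antecedents[OF this]
  obtain n S T A where j: "join_ok n S T A" "\<forall>j\<in>{1..n}. frj_irr G (S j) (T j) (A j)"
    "join_Ups n A = ?U" "join_SAt n S \<subseteq> \<Psi>"
    "\<Psi> \<subseteq> join_SAt n S \<union> join_TAt n T \<union> join_Simp n S \<union> join_Timp n T A"
  proof (rule refuted_join[of ?U G \<Psi>])
    show "finite ?U" using ant by simp
  qed (use assms in blast)+
  have "\<forall>Y\<in>join_Ups n A. \<exists>Z. Y \<^bold>\<supset> Z \<in> Sl G \<or> Y \<^bold>\<or> Z \<in> Sr G \<or> Z \<^bold>\<or> Y \<in> Sr G"
    using assms(1,2) bar_subset_Sl[of G] unfolding j(3) by blast
  with j assms have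
    "frj_reg G (join_SAt n S \<union> join_TAt n T \<union> join_Simp n S \<union> join_Timp n T A) (C \<^bold>\<or> D)"
    by (intro frj_reg_frj_irr.join_or) auto
  with j(5) show ?thesis unfolding refuted_reg_def by (blast intro: Cl_superset[THEN subsetD])
qed

section \<open>The dichotomy\<close>

text \<open>Read upwards, the irregular rules keep \<open>\<Psi>\<close> and shrink
  \<open>C\<close>, so structural induction works. The exception adds an \<open>A\<close> outside
  \<open>Cl \<Psi>\<close> and becomes regular; the last hypothesis covers it.\<close>

lemma irr_dichotomy:
  assumes "gbu_seq G \<Psi> C" "\<Psi> \<subseteq> bar G"
    and "\<And>A B. A \<notin> Cl \<Psi> \<Longrightarrow> gbu_seq G (insert A \<Psi>) B \<Longrightarrow>
      gbu_reg G (insert A \<Psi>) B \<or> refuted_reg G (insert A \<Psi>) B"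
  shows "gbu_irr G \<Psi> C \<or> refuted_irr G \<Psi> C"
  using assms(1)
proof (induction C)
  case (Var n)
  show ?case
  proof (cases "Var n \<in> \<Psi>")
    case True
    then show ?thesis using gbu_reg_gbu_irr.ax_irr[of G "Var n" \<Psi>] Var by (simp add: insert_absorb)
  next
    case False
    then have "\<Psi> \<subseteq> (bar_At G - {Var n}) \<union> bar_imp G" using assms(2) by (auto simp: bar_def)
    moreover have "Var n \<in> PV_bot" by (simp add: PV_bot_def)
    ultimately show ?thesis
      using frj_reg_frj_irr.ax_irr[of "Var n" G] Var unfolding refuted_irr_def gbu_seq_def by blast
  qed
next
  case Bot
  have "\<Psi> \<subseteq> (bar_At G - {\<^bold>\<bottom>}) \<union> bar_imp G"
    using assms(2) not_in_bar(1)[of G] by (auto simp: bar_def)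
  moreover have "\<^bold>\<bottom> \<in> PV_bot" by (simp add: PV_bot_def)
  ultimately show ?case
    using frj_reg_frj_irr.ax_irr[of "\<^bold>\<bottom>" G] Bot unfolding refuted_irr_def gbu_seq_def by blast
next
  case (And A B)
  then have "gbu_seq G \<Psi> A" "gbu_seq G \<Psi> B" "A \<^bold>\<and> B \<in> Sr G"
    by (auto simp: gbu_seq_def intro: Sl_Sr.intros)
  with And show ?case
    unfolding refuted_irr_def
    by (meson gbu_reg_gbu_irr.R_and_irr frj_reg_frj_irr.and1_irr frj_reg_frj_irr.and2_irr)
next
  case (Or A B)
  then have "gbu_seq G \<Psi> A" "gbu_seq G \<Psi> B" "A \<^bold>\<or> B \<in> Sr G"
    by (auto simp: gbu_seq_def intro: Sl_Sr.intros)
  with Or show ?case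
    by (meson gbu_reg_gbu_irr.R_or1_irr gbu_reg_gbu_irr.R_or2_irr refuted_irr_or)
next
  case (Imp A B)
  then have *: "gbu_seq G \<Psi> B" "gbu_seq G (insert A \<Psi>) B" "A \<^bold>\<supset> B \<in> Sr G" "finite \<Psi>"
    using finite_gbu_seq by (auto simp: gbu_seq_def intro: Sl_Sr.intros)
  show ?case
  proof (cases "A \<in> Cl \<Psi>")
    case True
    with * Imp show ?thesis by (meson gbu_reg_gbu_irr.R_imp_in_irr refuted_irr_imp_in)
  next
    case False
    with * Imp.prems assms(2,3) show ?thesis
      by (meson gbu_reg_gbu_irr.R_imp_notin_irr refuted_irr_imp_notin)
  qed
qed

text \<open>The size of a compound formula exceeds the sum of the sizes of its parts, so replacing a
  formula by its immediate parts lowers the weight of a finite set.\<close>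

definition weight :: "form set \<Rightarrow> nat" where
  "weight \<Psi> = (\<Sum>X\<in>\<Psi>. size X)"

lemma weight_insert_le: "finite \<Psi> \<Longrightarrow> weight (insert X \<Psi>) \<le> size X + weight \<Psi>"
  by (simp add: weight_def sum.insert_if)

lemma weight_remove: "finite \<Psi> \<Longrightarrow> X \<in> \<Psi> \<Longrightarrow> weight \<Psi> = size X + weight (\<Psi> - {X})"
  by (simp add: weight_def sum.remove)

text \<open>Left rules replace \<open>X\<close> by parts from which \<open>Cl\<close> rebuilds it,
  so the closure never shrinks.\<close>

lemma Cl_replace: "X \<in> Cl \<Phi> \<Longrightarrow> \<Psi> - {X} \<subseteq> \<Phi> \<Longrightarrow> \<Psi> \<subseteq> Cl \<Phi>"
  by (auto intro: Cl.intros)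

text \<open>\<open>reg\<close> is the induction hypothesis in lexicographic form: the closure grows,
  or the weight drops. Left rules for \<and> and \<or> come first; then
  \<open>\<Psi> \<subseteq> bar G\<close>, where irregular sequents and joins are available.\<close>

lemma reg_dichotomy_step:
  assumes seq: "gbu_seq G \<Psi> C"
    and reg: "\<And>\<Phi> D. gbu_seq G \<Phi> D \<Longrightarrow> \<Psi> \<subseteq> Cl \<Phi> \<Longrightarrow>
      \<not> Cl \<Phi> \<subseteq> Cl \<Psi> \<or> weight \<Phi> + size D < weight \<Psi> + size C \<Longrightarrow>
      gbu_reg G \<Phi> D \<or> refuted_reg G \<Phi> D"
  shows "gbu_reg G \<Psi> C \<or> refuted_reg G \<Psi> C"
proof -
  have fin: "finite \<Psi>" using seq by (rule finite_gbu_seq)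
  have refl: "\<Psi> \<subseteq> Cl \<Psi>" by (rule Cl_superset)
  consider (ax) "C \<in> \<Psi>" | (bot) "\<^bold>\<bottom> \<in> \<Psi>" | (conj) A B where "A \<^bold>\<and> B \<in> \<Psi>"
    | (disj) A B where "A \<^bold>\<or> B \<in> \<Psi>" | (bar) "\<Psi> \<subseteq> bar G" "C \<notin> \<Psi>"
  proof -
    have "\<Psi> \<subseteq> bar G" if "\<^bold>\<bottom> \<notin> \<Psi>" "\<forall>A B. A \<^bold>\<and> B \<notin> \<Psi>" "\<forall>A B. A \<^bold>\<or> B \<notin> \<Psi>"
    proof
      fix X assume "X \<in> \<Psi>"
      with that seq show "X \<in> bar G"
        by (cases X) (auto simp: bar_def bar_At_def bar_imp_def gbu_seq_def)
    qed
    then show thesis using ax bot conj disj bar by blast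
  qed
  then show ?thesis
  proof cases
    case ax
    then show ?thesis using gbu_reg_gbu_irr.ax_reg[of G C \<Psi>] seq by (simp add: insert_absorb)
  next
    case bot
    then show ?thesis using gbu_reg_gbu_irr.ax_bot[of G \<Psi> C] seq by (simp add: insert_absorb)
  next
    case (conj A B)
    \<comment> \<open>The principal formula is removed from the context; otherwise the weight would
      not drop.\<close>
    let ?\<Phi> = "insert A (insert B (\<Psi> - {A \<^bold>\<and> B}))"
    have "\<Psi> \<subseteq> Cl ?\<Phi>" by (rule Cl_replace[of "A \<^bold>\<and> B"]) (auto intro: Cl.intros)
    moreover have "weight ?\<Phi> < weight \<Psi>"
      using weight_remove[OF fin conj] weight_insert_le[of "insert B (\<Psi> - {A \<^bold>\<and> B})" A]
        weight_insert_le[of "\<Psi> - {A \<^bold>\<and> B}" B] fin by simp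
    moreover have "gbu_seq G ?\<Phi> C"
      using seq conj by (auto simp: gbu_seq_def intro: Sl_Sr.intros)
    moreover have "insert (A \<^bold>\<and> B) (\<Psi> - {A \<^bold>\<and> B}) = \<Psi>" using conj by blast
    ultimately show ?thesis
      using reg[of ?\<Phi> C] gbu_reg_gbu_irr.L_and[of G A B "\<Psi> - {A \<^bold>\<and> B}" C] seq
        refuted_reg_antimono[of G ?\<Phi> C \<Psi>] by auto
  next
    case (disj A B)
    have *: "gbu_reg G (insert X (\<Psi> - {A \<^bold>\<or> B})) C \<or> refuted_reg G \<Psi> C" if "X = A \<or> X = B" for X
    proof -
      let ?\<Phi> = "insert X (\<Psi> - {A \<^bold>\<or> B})"
      have "\<Psi> \<subseteq> Cl ?\<Phi>"
        by (rule Cl_replace[of "A \<^bold>\<or> B"]) (use that in \<open>auto intro: Cl.intros\<close>)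
      moreover have "weight ?\<Phi> < weight \<Psi>"
        using weight_remove[OF fin disj] weight_insert_le[of "\<Psi> - {A \<^bold>\<or> B}" X] fin that by auto
      moreover have "gbu_seq G ?\<Phi> C"
        using seq disj that by (auto simp: gbu_seq_def intro: Sl_Sr.intros)
      ultimately show ?thesis using reg[of ?\<Phi> C] refuted_reg_antimono[of G ?\<Phi> C \<Psi>] by auto
    qed
    moreover have "insert (A \<^bold>\<or> B) (\<Psi> - {A \<^bold>\<or> B}) = \<Psi>" using disj by blast
    ultimately show ?thesis
      using gbu_reg_gbu_irr.L_or[of G A "\<Psi> - {A \<^bold>\<or> B}" C B] seq by auto
  next
    case bar
    have irr: "gbu_irr G \<Psi> D \<or> refuted_irr G \<Psi> D" if "D \<in> Sr G" for D
    proof (rule irr_dichotomy)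
      show "gbu_seq G \<Psi> D" using seq that by (simp add: gbu_seq_def)
      show "gbu_reg G (insert A \<Psi>) B \<or> refuted_reg G (insert A \<Psi>) B"
        if "A \<notin> Cl \<Psi>" "gbu_seq G (insert A \<Psi>) B" for A B
      proof (rule reg)
        \<comment> \<open>\<open>A\<close> witnesses that the closure grows, whatever happens to the
          weight.\<close>
        have "A \<in> Cl (insert A \<Psi>)" using Cl_superset by blast
        with that(1) show "\<not> Cl (insert A \<Psi>) \<subseteq> Cl \<Psi> \<or>
          weight (insert A \<Psi>) + size B < weight \<Psi> + size C" by blast
      qed (use that Cl_superset in blast)+
    qed (fact bar)
    \<comment> \<open>Unless the sequent is already decided, every antecedent in
      \<open>\<Psi>\<close> is refuted, as the joins demand.\<close>
    have left: "gbu_reg G \<Psi> C \<or> refuted_reg G \<Psi> C \<or> refuted_irr G \<Psi> Y" if YZ: "Y \<^bold>\<supset> Z \<in> \<Psi>" for Y Z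
    proof -
      let ?\<Phi> = "insert Z (\<Psi> - {Y \<^bold>\<supset> Z})"
      have "\<Psi> \<subseteq> Cl ?\<Phi>" by (rule Cl_replace[of "Y \<^bold>\<supset> Z"]) (auto intro: Cl.intros)
      moreover have "weight ?\<Phi> < weight \<Psi>"
        using weight_remove[OF fin YZ] weight_insert_le[of "\<Psi> - {Y \<^bold>\<supset> Z}" Z] fin by simp
      moreover have "gbu_seq G ?\<Phi> C"
        using seq YZ by (auto simp: gbu_seq_def intro: Sl_Sr.intros)
      ultimately have "gbu_reg G ?\<Phi> C \<or> refuted_reg G \<Psi> C"
        using reg[of ?\<Phi> C] refuted_reg_antimono[of G ?\<Phi> C \<Psi>] by auto
      moreover have "insert (Y \<^bold>\<supset> Z) (\<Psi> - {Y \<^bold>\<supset> Z}) = \<Psi>" using YZ by blast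
      moreover have "Y \<in> Sr G" using seq YZ by (auto simp: gbu_seq_def intro: Sl_Sr.intros)
      ultimately show ?thesis
        using gbu_reg_gbu_irr.L_imp[of G Y Z "\<Psi> - {Y \<^bold>\<supset> Z}" C] seq irr[of Y] by auto
    qed
    have C: "C \<in> Sr G" using seq by (simp add: gbu_seq_def)
    show ?thesis
    proof (cases C)
      case (Var n)
      then show ?thesis using left refuted_reg_atom[of C G \<Psi>] C bar by (auto simp: PV_bot_def)
    next
      case Bot
      then show ?thesis using left refuted_reg_atom[of C G \<Psi>] C bar by (auto simp: PV_bot_def)
    next
      case (And A B)
      then have "gbu_seq G \<Psi> A" "gbu_seq G \<Psi> B"
        using seq by (auto simp: gbu_seq_def intro: Sl_Sr.intros)
      moreover from this have "gbu_reg G \<Psi> A \<or> refuted_reg G \<Psi> A" "gbu_reg G \<Psi> B \<or> refuted_reg G \<Psi> B"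
        using reg refl And by simp_all
      ultimately show ?thesis
        using seq C unfolding And refuted_reg_def
        by (meson gbu_reg_gbu_irr.R_and_reg frj_reg_frj_irr.and1_reg frj_reg_frj_irr.and2_reg)
    next
      case (Or A B)
      then have "A \<in> Sr G" "B \<in> Sr G" using C by (auto intro: Sl_Sr.intros)
      with irr have "gbu_reg G \<Psi> C \<or> refuted_irr G \<Psi> A \<and> refuted_irr G \<Psi> B"
        using seq unfolding Or by (meson gbu_reg_gbu_irr.R_or1_reg gbu_reg_gbu_irr.R_or2_reg)
      then show ?thesis using left refuted_reg_or[of A B G \<Psi>] C bar Or by blast
    next
      case (Imp A B)
      then have seqs: "gbu_seq G \<Psi> B" "gbu_seq G (insert A \<Psi>) B"
        using seq by (auto simp: gbu_seq_def intro: Sl_Sr.intros)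
      show ?thesis
      proof (cases "A \<in> Cl \<Psi>")
        case True
        have "gbu_reg G \<Psi> B \<or> refuted_reg G \<Psi> B" using reg seqs(1) refl Imp by simp
        then show ?thesis
          using True seq C unfolding Imp by (meson gbu_reg_gbu_irr.R_imp_in_reg refuted_reg_imp)
      next
        case False
        \<comment> \<open>A refutation for \<open>insert A \<Psi>\<close> has \<open>A\<close> in
          its closure, so it refutes the implication there and hence over
          \<open>\<Psi>\<close>.\<close>
        have A: "A \<in> Cl (insert A \<Psi>)" "\<Psi> \<subseteq> Cl (insert A \<Psi>)" using Cl_superset by blast+
        with False have "gbu_reg G (insert A \<Psi>) B \<or> refuted_reg G (insert A \<Psi>) B"
          using reg[of "insert A \<Psi>" B] seqs(2) by blast
        then show ?thesis
          using A False seq C unfolding Imp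
          by (meson gbu_reg_gbu_irr.R_imp_notin_reg refuted_reg_imp refuted_reg_antimono)
      qed
    qed
  qed
qed

text \<open>The closure is measured by the finitely many formulas of \<open>Sl G\<close> still
  outside it; the weight breaks ties.\<close>

lemma reg_dichotomy: "gbu_seq G \<Psi> C \<Longrightarrow> gbu_reg G \<Psi> C \<or> refuted_reg G \<Psi> C"
proof (induction "(\<Psi>, C)" arbitrary: \<Psi> C
    rule: wf_induct_rule[OF wf_measures[of "[\<lambda>(\<Psi>, C). card (Sl G - Cl \<Psi>), \<lambda>(\<Psi>, C). weight \<Psi> + size C]"]])
  case (1 \<Psi> C)
  show ?case
  proof (rule reg_dichotomy_step[OF 1(2)])
    fix \<Phi> D
    assume *: "gbu_seq G \<Phi> D" "\<Psi> \<subseteq> Cl \<Phi>"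
      "\<not> Cl \<Phi> \<subseteq> Cl \<Psi> \<or> weight \<Phi> + size D < weight \<Psi> + size C"
    have sub: "Cl \<Psi> \<subseteq> Cl \<Phi>" using Cl_least *(2) by blast
    show "gbu_reg G \<Phi> D \<or> refuted_reg G \<Phi> D"
    proof (rule 1(1)[OF _ *(1)])
      have "card (Sl G - Cl \<Phi>) < card (Sl G - Cl \<Psi>)" if n: "\<not> Cl \<Phi> \<subseteq> Cl \<Psi>"
      proof (rule psubset_card_mono)
        \<comment> \<open>Growth of the closure shows already on a generator in
          \<open>\<Phi>\<close>, which lies in \<open>Sl G\<close> and so is counted.\<close>
        have "\<not> \<Phi> \<subseteq> Cl \<Psi>" using Cl_least n by blast
        then obtain X where "X \<in> \<Phi>" "X \<notin> Cl \<Psi>" by blast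
        moreover have "X \<in> Sl G" using *(1) \<open>X \<in> \<Phi>\<close> by (auto simp: gbu_seq_def)
        moreover have "X \<in> Cl \<Phi>" using \<open>X \<in> \<Phi>\<close> by (rule Cl.intros)
        ultimately show "Sl G - Cl \<Phi> \<subset> Sl G - Cl \<Psi>" using sub by blast
      qed (use finite_Sl in blast)
      moreover have "card (Sl G - Cl \<Phi>) \<le> card (Sl G - Cl \<Psi>)"
        using sub finite_Sl by (intro card_mono) auto
      ultimately show "((\<Phi>, D), (\<Psi>, C)) \<in> measures
        [\<lambda>(\<Psi>, C). card (Sl G - Cl \<Psi>), \<lambda>(\<Psi>, C). weight \<Psi> + size C]"
        using *(3) by auto
    qed
  qed
qed

theorem theorem5p12:
  fixes G :: form
  shows "(G \<notin> IPL \<longrightarrow> (\<exists>\<Gamma>. frj_reg G \<Gamma> G)) \<and> (G \<in> IPL \<longrightarrow> gbu_reg G {} G)"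
proof -
  have "gbu_seq G {} G" by (simp add: gbu_seq_def Sl_Sr.intros)
  then have "gbu_reg G {} G \<or> (\<exists>\<Gamma>. frj_reg G \<Gamma> G)"
    using reg_dichotomy unfolding refuted_reg_def by blast
  moreover have "G \<in> IPL" if "gbu_reg G {} G"
    using gbu_sound(1)[OF that] by (simp add: IPL_def)
  moreover have "G \<notin> IPL" if "frj_reg G \<Gamma> G" for \<Gamma>
    using that by (rule frj_sound)
  ultimately show ?thesis by blast
qed

end
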